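(* Let $0<p\le 1$, let $n\ge 0$ be an integer, and let $Q(n)=[-n,n]^2\cap\mathbb{Z}^2$. Consider the Lorentz mirror model on $\mathbb{Z}^2$ with mirror density $p$, with law $\mathbb{P}_p$, and let $[0\leftrightarrow Q(n)^c]$ be the event that the ray of light starting at the origin (emitted from $(0,0)$ along an incident edge in a fixed one of the four coordinate directions) reaches some vertex of $Q(n)^c=\mathbb{Z}^2\setminus Q(n)$. Then \[ \mathbb{P}_p\bigl(0\leftrightarrow Q(n)^c\bigr)\ \ge\ \frac{1}{2n+1}. \]
   Context: Lorentz mirror model on $\mathbb{Z}^2$ with density $p\in[0,1]$: independently and identically for each vertex $x\in\mathbb{Z}^2$, the vertex $x$ has a north-east mirror (drawn "/") with probability $p/2$, a north-west mirror (drawn "\") with probability $p/2$, and no mirror with probability $1-p$. The law of this random configuration is $\mathbb{P}_p$. Mirrors are double-sided. Ray of light: given a configuration, a ray of light travels along the nearest-neighbour edges of $\mathbb{Z}^2$. Write east $=(1,0)$, west $=(-1,0)$, north $=(0,1)$, south $=(0,-1)$. When the ray arrives at a vertex $x$ travelling in direction $d$, it leaves $x$ in direction $d'$, moving to the vertex $x+d'$, where: - if $x$ has no mirror, $d'=d$; - if $x$ has a north-east mirror ("/"), east $\mapsto$ north, north $\mapsto$ east, west $\mapsto$ south, south $\mapsto$ west; - if $x$ has a north-west mirror ("\"), east $\mapsto$ south, south $\mapsto$ east, west $\mapsto$ north, north $\mapsto$ west. The ray starting at the origin in direction $d_0$ leaves $(0,0)$ in direction $d_0$, so that its first step is to the vertex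 $d_0$ (the mirror at the origin, if any, acts only if the ray later returns to the origin), and from then on, for all time, whenever it arrives at a vertex $x$ in direction $d$ it moves on to the vertex $x+d'$, with $d'$ determined by $d$ and the mirror (or absence of a mirror) at $x$. Here $d_0$ is one of the four coordinate directions, fixed in advance (non-random). For $A\subset\mathbb{Z}^2$, $[0\leftrightarrow A]$ denotes the event that this ray visits some vertex of $A$. *)

theory Defs
  imports "HOL-Probability.Probability"
begin

datatype mirror = NorthEast | NorthWest | NoMirror

datatype direction = East | West | North | South

type_synonym vertex = "int \<times> int"

type_synonym configuration = "vertex \<Rightarrow> mirror"

fun unit_step :: "direction \<Rightarrow> vertex" where
  "unit_step East = (1, 0)"
| "unit_step West = (-1, 0)"
| "unit_step North = (0, 1)"
| "unit_step South = (0, -1)"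

fun deflect :: "mirror \<Rightarrow> direction \<Rightarrow> direction" where
  "deflect NoMirror d = d"
| "deflect NorthEast East = North"
| "deflect NorthEast North = East"
| "deflect NorthEast West = South"
| "deflect NorthEast South = West"
| "deflect NorthWest East = South"
| "deflect NorthWest South = East"
| "deflect NorthWest West = North"
| "deflect NorthWest North = West"

(* The state after k steps is the current vertex together with the direction in which the ray
   leaves it; hence the mirror at the origin plays no role at time 0, only upon a return. *)
fun ray :: "configuration \<Rightarrow> direction \<Rightarrow> nat \<Rightarrow> vertex \<times> direction" where
  "ray \<omega> d\<^sub>0 0 = ((0, 0), d\<^sub>0)"
| "ray \<omega> d\<^sub>0 (Suc k) =
     (let (x, d) = ray \<omega> d\<^sub>0 k; y = x + unit_step d in (y, deflect (\<omega> y) d))"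

definition ray_reaches :: "configuration \<Rightarrow> direction \<Rightarrow> vertex set \<Rightarrow> bool" where
  "ray_reaches \<omega> d\<^sub>0 A \<longleftrightarrow> (\<exists>k. fst (ray \<omega> d\<^sub>0 k) \<in> A)"

definition mirror_pmf :: "real \<Rightarrow> mirror pmf" where
  "mirror_pmf p = bind_pmf (bernoulli_pmf p)
     (\<lambda>b. if b then pmf_of_set {NorthEast, NorthWest} else return_pmf NoMirror)"

lemma pmf_mirror_pmf:
  assumes "0 \<le> p" "p \<le> 1"
  shows "pmf (mirror_pmf p) NorthEast = p / 2"
    and "pmf (mirror_pmf p) NorthWest = p / 2"
    and "pmf (mirror_pmf p) NoMirror = 1 - p"
  using assms by (simp_all add: mirror_pmf_def pmf_bind)

definition mirror_model :: "real \<Rightarrow> configuration measure" where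
  "mirror_model p = (\<Pi>\<^sub>M x\<in>UNIV. measure_pmf (mirror_pmf p))"

lemma space_mirror_model: "space (mirror_model p) = UNIV"
  by (auto simp: mirror_model_def space_PiM)

lemma prob_space_mirror_model: "prob_space (mirror_model p)"
  unfolding mirror_model_def by (intro prob_space_PiM measure_pmf.prob_space_axioms)

instance direction :: countable
  by countable_datatype

lemma measurable_ray: "(\<lambda>\<omega>. ray \<omega> d\<^sub>0 k) \<in> measurable (mirror_model p) (count_space UNIV)"
proof (induction k)
  case 0
  show ?case unfolding ray.simps by (rule measurable_const) simp
next
  case (Suc k)
  have site: "(\<lambda>\<omega>. \<omega> y) \<in> measurable (mirror_model p) (count_space UNIV)" for y
  proof -
    have "(\<lambda>\<omega>. \<omega> y) \<in> measurable (mirror_model p) (measure_pmf (mirror_pmf p))"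
      unfolding mirror_model_def by (rule measurable_component_singleton) (rule UNIV_I)
    then show ?thesis unfolding measurable_pmf_measure2 .
  qed
  define next_state :: "vertex \<times> direction \<Rightarrow> configuration \<Rightarrow> vertex \<times> direction"
    where "next_state s \<omega> = (let (x, d) = s; y = x + unit_step d in (y, deflect (\<omega> y) d))"
    for s \<omega>
  have "next_state s \<in> measurable (mirror_model p) (count_space UNIV)" for s
  proof -
    obtain x d where s: "s = (x, d)" by (cases s)
    have "next_state s = (\<lambda>\<omega>. (\<lambda>m. (x + unit_step d, deflect m d)) (\<omega> (x + unit_step d)))"
      unfolding s next_state_def Let_def prod.case ..
    moreover have "(\<lambda>\<omega>. (\<lambda>m. (x + unit_step d, deflect m d)) (\<omega> (x + unit_step d)))
        \<in> measurable (mirror_model p) (count_space UNIV)"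
      by (rule measurable_compose[OF site]) (simp only: measurable_count_space_eq1 space_count_space Pi_UNIV UNIV_I)
    ultimately show ?thesis by (simp only:)
  qed
  then have "(\<lambda>\<omega>. next_state (ray \<omega> d\<^sub>0 k) \<omega>) \<in> measurable (mirror_model p) (count_space UNIV)"
    using Suc.IH by (rule measurable_compose_countable)
  then show ?case unfolding ray.simps next_state_def .
qed

lemma sets_ray_reaches:
  "{\<omega> \<in> space (mirror_model p). ray_reaches \<omega> d\<^sub>0 A} \<in> sets (mirror_model p)"
proof -
  have "{\<omega> \<in> space (mirror_model p). fst (ray \<omega> d\<^sub>0 k) \<in> A} \<in> sets (mirror_model p)" for k
  proof -
    have "(\<lambda>\<omega>. ray \<omega> d\<^sub>0 k) -` (fst -` A) \<inter> space (mirror_model p) \<in> sets (mirror_model p)"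
      by (rule measurable_sets[OF measurable_ray]) (simp only: sets_count_space Pow_UNIV UNIV_I)
    also have "(\<lambda>\<omega>. ray \<omega> d\<^sub>0 k) -` (fst -` A) \<inter> space (mirror_model p)
        = {\<omega> \<in> space (mirror_model p). fst (ray \<omega> d\<^sub>0 k) \<in> A}" by blast
    finally show ?thesis .
  qed
  then show ?thesis unfolding ray_reaches_def by (rule sets.sets_Collect_countable_Ex)
qed

definition lattice_box :: "nat \<Rightarrow> vertex set" where
  "lattice_box n = {- int n..int n} \<times> {- int n..int n}"

end

theory Submission
  imports Defs
begin

text \<open>
  Only the mirrors in the box matter until the ray leaves it, so roll the columns of the box up
  into a cylinder of odd circumference \<open>2n + 1\<close>. Consider the \<open>2n + 1\<close> rays entering row 1 of the
  cylinder from row 0. Each of them leaves the rows \<open>1, \<dots>, n\<close> again; as the motion is reversible,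
  those that leave back through row 0 are matched in pairs, and so by parity at least one
  reaches row \<open>n + 1\<close>. Rotating the cylinder preserves the law of the mirrors, so the
  ray from the origin does this with probability at least \<open>1 / (2n + 1)\<close>, and when it does the planar
  ray has left the box.
\<close>

section \<open>Parity of escaping orbits of a reversible map\<close>

lemma even_card_involution:
  assumes "finite B" and "\<And>x. x \<in> B \<Longrightarrow> f x \<in> B \<and> f (f x) = x \<and> f x \<noteq> x"
  shows "even (card B)"
proof -
  let ?C = "(\<lambda>x. {x, f x}) ` B"
  have "\<Union> ?C = B"
    using assms(2) by blast
  moreover have "2 * card ?C = card (\<Union> ?C)"
  proof (rule card_partition)
    show "c \<inter> c' = {}" if "c \<in> ?C" "c' \<in> ?C" "c \<noteq> c'" for c c'
    proof -
      obtain x y where "x \<in> B" "c = {x, f x}" "y \<in> B" "c' = {y, f y}"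
        using \<open>c \<in> ?C\<close> \<open>c' \<in> ?C\<close> by blast
      then show ?thesis
        using assms(2)[of x] assms(2)[of y] \<open>c \<noteq> c'\<close> by (metis disjoint_iff insert_commute insert_iff empty_iff)
    qed
    show "card c = 2" if c: "c \<in> ?C" for c
    proof -
      obtain x where "x \<in> B" "c = {x, f x}"
        using c by blast
      then show ?thesis
        using assms(2)[of x] by (metis card_2_iff)
    qed
    show "finite (\<Union> ?C)" "finite ?C"
      using assms(1) by simp_all
  qed
  ultimately show ?thesis
    by (metis dvd_triv_left)
qed

text \<open>By hypothesis one step from \<open>R (F s)\<close> leads back to \<open>R s\<close>;
  iterated, the motion retraces a reversed orbit.\<close>

lemma funpow_reversal:
  assumes "\<And>s. F (R (F s)) = R s" and "i \<le> k"
  shows "(F ^^ i) (R ((F ^^ k) s)) = R ((F ^^ (k - i)) s)"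
  using assms(2)
proof (induction i)
  case (Suc i)
  then have "k - i = Suc (k - Suc i)"
    by simp
  then show ?case
    using Suc by (simp add: assms(1))
qed simp

text \<open>An orbit confined to the finite set \<open>A\<close> repeats a state. Reversibility
  pushes the repetition back to time 0, so \<open>s\<close> would be the image of a state in
  \<open>A\<close>, which \<open>F_A\<close> forbids.\<close>

lemma reversible_orbit_exits:
  fixes F R :: "'s \<Rightarrow> 's"
  assumes reversible: "\<And>s. F (R (F s)) = R s"
    and R_R: "\<And>s. s \<in> V \<Longrightarrow> R (R s) = s"
    and F_V: "\<And>s. F s \<in> V" and "B \<subseteq> V"
    and "finite A" and F_A: "\<And>s. s \<in> A \<Longrightarrow> F s \<notin> B"
    and "s \<in> B"
  shows "\<exists>k. (F ^^ k) s \<notin> A"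
proof (rule ccontr)
  assume "\<not> ?thesis"
  then have in_A: "(F ^^ k) s \<in> A" for k
    by simp
  have in_V: "(F ^^ k) s \<in> V" for k
    using F_V \<open>s \<in> B\<close> \<open>B \<subseteq> V\<close> by (cases k) auto
  have "\<not> inj (\<lambda>k. (F ^^ k) s)"
    using in_A \<open>finite A\<close> by (meson finite_subset image_subsetI range_inj_infinite)
  then obtain i j where "i < j" and eq: "(F ^^ i) s = (F ^^ j) s"
    unfolding inj_def by (metis linorder_neqE_nat)
  have "R s = R ((F ^^ (j - i)) s)"
    using funpow_reversal[of F R, OF reversible, of i i s]
      funpow_reversal[of F R, OF reversible, of i j s] \<open>i < j\<close> eq by simp
  then have "s = (F ^^ (j - i)) s"
    using R_R in_V[of 0] in_V[of "j - i"] by (metis funpow_0)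
  also have "\<dots> = F ((F ^^ (j - i - 1)) s)"
    using \<open>i < j\<close> by (metis Suc_diff_1 funpow.simps(2) o_apply zero_less_diff)
  finally show False
    using F_A[OF in_A] \<open>s \<in> B\<close> by metis
qed

text \<open>An orbit ending in the reversal of its start is its own reversal. At its midpoint it
  would contain a state equal to its reversal (\<open>k\<close> even) or a step from a state onto
  its reversal (\<open>k\<close> odd).\<close>

lemma reversible_orbit_no_backtrack:
  fixes F R :: "'s \<Rightarrow> 's"
  assumes reversible: "\<And>s. F (R (F s)) = R s"
    and no_fixpoint: "\<And>s. R s \<noteq> s" "\<And>s. F s \<noteq> R s"
    and "R (R s) = s"
  shows "(F ^^ k) s \<noteq> R s"
proof
  assume eq: "(F ^^ k) s = R s"
  define j where "j = k div 2"
  have *: "(F ^^ j) s = R ((F ^^ (k - j)) s)"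
    using funpow_reversal[of F R, OF reversible, of j k s] eq \<open>R (R s) = s\<close>
    by (simp add: j_def)
  show False
  proof (cases "even k")
    case True
    then have "k - j = j"
      by (auto simp: j_def)
    then show False
      using * no_fixpoint(1) by metis
  next
    case False
    then have "k - j = Suc j"
      by (auto simp: j_def elim: oddE)
    \<comment> \<open>With \<open>t = (F ^^ j) s\<close> the equation reads
      \<open>t = R (F t)\<close>; applying \<open>F\<close> gives \<open>F t = R t\<close>.\<close>
    then show False
      using * reversible no_fixpoint(2) by (metis funpow.simps(2) o_apply)
  qed
qed

text \<open>
  Think of a state as a directed edge, with \<open>F\<close> the motion and \<open>R\<close> the reversal of an edge.
  The edges in \<open>B\<close> enter a region, and \<open>A\<close> consists of the edges whose head lies in the region.
\<close>

lemma reversible_parity: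
  fixes F R :: "'s \<Rightarrow> 's"
  assumes reversible: "\<And>s. F (R (F s)) = R s"
    and R_R: "\<And>s. s \<in> V \<Longrightarrow> R (R s) = s"
    and no_fixpoint: "\<And>s. R s \<noteq> s" "\<And>s. F s \<noteq> R s"
    and F_V: "\<And>s. F s \<in> V" and "B \<subseteq> V"
    and "finite A" and F_A: "\<And>s. s \<in> A \<Longrightarrow> F s \<notin> B" "\<And>s. s \<in> A \<Longrightarrow> R (F s) \<in> A"
    and R_B: "R ` B \<inter> A = {}" and "odd (card B)"
  obtains s k where "s \<in> B" "(F ^^ k) s \<notin> A" "(F ^^ k) s \<notin> R ` B" "\<And>i. i < k \<Longrightarrow> (F ^^ i) s \<in> A"
proof (rule ccontr)
  note escape = that
  assume no_escape: "\<not> thesis"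
  \<comment> \<open>Reversals of states in \<open>B\<close> lie outside \<open>A\<close>, so for
    \<open>s'\<close> in \<open>B\<close> the witness \<open>k\<close> is the first exit time of
    \<open>s\<close>. If no orbit escapes, this relation is a fixed-point-free involution of
    \<open>B\<close>.\<close>
  define matched where
    "matched s s' \<longleftrightarrow> (\<exists>k. (F ^^ k) s = R s' \<and> (\<forall>i<k. (F ^^ i) s \<in> A))" for s s'
  have matched_ex: "\<exists>s'\<in>B. matched s s'" if "s \<in> B" for s
  proof -
    have ex: "\<exists>k. (F ^^ k) s \<notin> A"
      using reversible_orbit_exits[of F R V B A s] reversible R_R F_V \<open>B \<subseteq> V\<close> \<open>finite A\<close> F_A(1) that
      by blast
    define k where "k = (LEAST k. (F ^^ k) s \<notin> A)"
    have "(F ^^ k) s \<notin> A"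
      unfolding k_def using ex by (rule LeastI_ex)
    moreover have *: "(F ^^ i) s \<in> A" if "i < k" for i
      using not_less_Least that unfolding k_def by blast
    ultimately have "(F ^^ k) s \<in> R ` B"
      using no_escape \<open>s \<in> B\<close> escape by blast
    then show ?thesis
      using * unfolding matched_def by blast
  qed
  have matched_sym: "matched s' s" if "s \<in> B" "s' \<in> B" "matched s s'" for s s'
  proof -
    obtain k where k: "(F ^^ k) s = R s'" and *: "\<And>i. i < k \<Longrightarrow> (F ^^ i) s \<in> A"
      using \<open>matched s s'\<close> unfolding matched_def by blast
    \<comment> \<open>The orbit of \<open>s'\<close> runs through the reversals of the orbit of
      \<open>s\<close> in the opposite order.\<close>
    have rev: "(F ^^ i) s' = R ((F ^^ (k - i)) s)" if "i \<le> k" for i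
      using funpow_reversal[of F R, OF reversible that, of s] k R_R[of s'] \<open>s' \<in> B\<close> \<open>B \<subseteq> V\<close>
      by auto
    have "(F ^^ i) s' \<in> A" if "i < k" for i
    proof -
      have "k - i = Suc (k - Suc i)"
        using that by simp
      then have "(F ^^ i) s' = R (F ((F ^^ (k - Suc i)) s))"
        using rev[of i] that by simp
      then show ?thesis
        using F_A(2) * that by simp
    qed
    moreover have "(F ^^ k) s' = R s"
      using rev[of k] by simp
    ultimately show ?thesis
      unfolding matched_def by blast
  qed
  have matched_unique: "s' = s''"
    if "s' \<in> B" "s'' \<in> B" "matched s s'" "matched s s''" for s s' s''
  proof -
    obtain k l where k: "(F ^^ k) s = R s'" "\<And>i. i < k \<Longrightarrow> (F ^^ i) s \<in> A"
      and l: "(F ^^ l) s = R s''" "\<And>i. i < l \<Longrightarrow> (F ^^ i) s \<in> A"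
      using \<open>matched s s'\<close> \<open>matched s s''\<close> unfolding matched_def by metis
    have "(F ^^ k) s \<notin> A" "(F ^^ l) s \<notin> A"
      using k(1) l(1) R_B \<open>s' \<in> B\<close> \<open>s'' \<in> B\<close> by auto
    then have "k = l"
      using k(2)[of l] l(2)[of k] by (cases k l rule: linorder_cases) auto
    then have "R s' = R s''"
      using k l by simp
    then show ?thesis
      using R_R \<open>s' \<in> B\<close> \<open>s'' \<in> B\<close> \<open>B \<subseteq> V\<close> by (metis subsetD)
  qed
  have matched_irrefl: "\<not> matched s s" if "s \<in> B" for s
    using reversible_orbit_no_backtrack[of F R s, OF reversible no_fixpoint] R_R that \<open>B \<subseteq> V\<close>
    unfolding matched_def by blast
  define f where "f s = (SOME s'. s' \<in> B \<and> matched s s')" for s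
  have f: "f s \<in> B \<and> matched s (f s)" if "s \<in> B" for s
    unfolding f_def using someI_ex[of "\<lambda>s'. s' \<in> B \<and> matched s s'"] matched_ex[OF that] by blast
  have "even (card B)"
  proof (rule even_card_involution)
    \<comment> \<open>An infinite set has \<open>card\<close> equal to 0, which is even.\<close>
    show "finite B"
      using \<open>odd (card B)\<close> card.infinite by fastforce
    show "f s \<in> B \<and> f (f s) = s \<and> f s \<noteq> s" if "s \<in> B" for s
      using f[OF that] f[of "f s"] matched_sym[OF that] matched_unique[of "f (f s)" s "f s"]
        matched_irrefl[OF that] that by metis
  qed
  then show False
    using \<open>odd (card B)\<close> by simp
qed

section \<open>The mirror model on a cylinder\<close>

text \<open>The quotient map from plane to cylinder, with representatives chosen so that the box is
  fixed pointwise.\<close>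

definition wrap :: "nat \<Rightarrow> vertex \<Rightarrow> vertex" where
  "wrap n v = ((fst v + int n) mod (2 * int n + 1) - int n, snd v)"

definition strip :: "nat \<Rightarrow> vertex set" where
  "strip n = {- int n..int n} \<times> UNIV"

fun opposite :: "direction \<Rightarrow> direction" where
  "opposite East = West"
| "opposite West = East"
| "opposite North = South"
| "opposite South = North"

definition cylinder_step :: "nat \<Rightarrow> configuration \<Rightarrow> vertex \<times> direction \<Rightarrow> vertex \<times> direction" where
  "cylinder_step n \<omega> s =
     (let w = wrap n (fst s + unit_step (snd s)) in (w, deflect (\<omega> w) (snd s)))"

text \<open>A state is a directed edge, given by tail and direction; the reversed edge has the old
  head as its tail.\<close>

definition cylinder_reverse :: "nat \<Rightarrow> vertex \<times> direction \<Rightarrow> vertex \<times> direction" where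
  "cylinder_reverse n s = (wrap n (fst s + unit_step (snd s)), opposite (snd s))"

lemma snd_wrap [simp]: "snd (wrap n v) = snd v"
  by (simp add: wrap_def)

lemma wrap_in_strip: "wrap n v \<in> strip n"
  using pos_mod_bound[of "2 * int n + 1" "fst v + int n"]
    pos_mod_sign[of "2 * int n + 1" "fst v + int n"]
  by (auto simp: wrap_def strip_def)

lemma wrap_id: "v \<in> strip n \<Longrightarrow> wrap n v = v"
  by (auto simp: wrap_def strip_def mod_pos_pos_trivial)

lemma wrap_wrap_add: "wrap n (wrap n v + u) = wrap n (v + u)"
proof -
  have "((fst v + int n) mod (2 * int n + 1) + fst u) mod (2 * int n + 1)
      = (fst v + int n + fst u) mod (2 * int n + 1)"
    by (rule mod_add_left_eq)
  then show ?thesis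
    by (simp add: wrap_def ac_simps)
qed

lemma wrap_wrap_diff: "wrap n (wrap n v - u) = wrap n (v - u)"
  using wrap_wrap_add[of n v "- u"] by simp

lemma unit_step_opposite: "unit_step (opposite d) = - unit_step d"
  by (cases d) auto

lemma opposite_opposite: "opposite (opposite d) = d"
  by (cases d) auto

lemma opposite_neq: "opposite d \<noteq> d"
  by (cases d) auto

lemma deflect_neq_opposite: "deflect m d \<noteq> opposite d"
  by (cases m; cases d) auto

lemma deflect_opposite_deflect: "deflect m (opposite (deflect m d)) = opposite d"
  by (cases m; cases d) auto

lemma finite_UNIV_direction: "finite (UNIV :: direction set)"
proof -
  have "(UNIV :: direction set) = {East, West, North, South}"
    using direction.exhaust by auto
  then show ?thesis
    by (metis finite.emptyI finite.insertI)
qed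

text \<open>Light sent back along the edge on which it left a vertex departs along the edge on which
  it had arrived (\<open>deflect_opposite_deflect\<close>).\<close>

lemma cylinder_step_reverse:
  "cylinder_step n \<omega> (cylinder_reverse n (cylinder_step n \<omega> s)) = cylinder_reverse n s"
  by (simp add: cylinder_step_def cylinder_reverse_def Let_def wrap_wrap_diff unit_step_opposite
      wrap_id[OF wrap_in_strip] deflect_opposite_deflect)

lemma cylinder_reverse_reverse:
  "fst s \<in> strip n \<Longrightarrow> cylinder_reverse n (cylinder_reverse n s) = s"
  by (simp add: cylinder_reverse_def wrap_wrap_diff unit_step_opposite opposite_opposite wrap_id
      prod_eq_iff)

text \<open>\<open>reversible_parity\<close> applies to the \<open>2 * n + 1\<close> northward edges
  from row 0 to row 1; an orbit that leaves rows 1 to \<open>n\<close> but not through row 0 enters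
  row \<open>n + 1\<close>.\<close>

lemma cylinder_escape:
  obtains x k where "x \<in> {- int n..int n}"
    and "snd (fst ((cylinder_step n \<omega> ^^ Suc k) ((x, 0), North))) = int n + 1"
proof -
  let ?F = "cylinder_step n \<omega>" and ?R = "cylinder_reverse n"
  define B where "B = (\<lambda>x. ((x, 0 :: int), North)) ` {- int n..int n}"
  define head where "head s = snd (fst s) + snd (unit_step (snd s))" for s :: "vertex \<times> direction"
  \<comment> \<open>The bounds on the tail make \<open>A\<close> finite and exclude no cylinder edge
    with head in rows 1 to \<open>n\<close>, since a step changes the row by at most 1.\<close>
  define A where "A = {s. fst s \<in> {- int n..int n} \<times> {0..int n + 1} \<and> head s \<in> {1..int n}}"
  have step: "snd (unit_step d) \<in> {-1, 0, 1}" for d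
    by (cases d) auto
  have F: "fst (?F s) \<in> strip n" "snd (fst (?F s)) = head s" for s
    using wrap_in_strip by (auto simp: cylinder_step_def Let_def head_def)
  have R: "fst (?R s) \<in> strip n" "snd (fst (?R s)) = head s" "head (?R s) = snd (fst s)" for s
    using wrap_in_strip by (auto simp: cylinder_reverse_def head_def unit_step_opposite)
  obtain s k where sk: "s \<in> B" "(?F ^^ k) s \<notin> A" "(?F ^^ k) s \<notin> ?R ` B"
      "\<And>i. i < k \<Longrightarrow> (?F ^^ i) s \<in> A"
  proof (rule reversible_parity[of ?F ?R "{s. fst s \<in> strip n}" B A])
    show "?F (?R (?F s)) = ?R s" for s
      by (rule cylinder_step_reverse)
    show "?R (?R s) = s" if "s \<in> {s. fst s \<in> strip n}" for s
      using that by (simp add: cylinder_reverse_reverse)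
    show "?R s \<noteq> s" for s
      using opposite_neq by (metis cylinder_reverse_def snd_conv)
    show "?F s \<noteq> ?R s" for s
      using deflect_neq_opposite by (metis cylinder_reverse_def cylinder_step_def snd_conv)
    show "?F s \<in> {s. fst s \<in> strip n}" for s
      using F by simp
    show "B \<subseteq> {s. fst s \<in> strip n}"
      by (auto simp: B_def strip_def)
    have "A \<subseteq> ({- int n..int n} \<times> {0..int n + 1}) \<times> UNIV"
      by (auto simp: A_def)
    then show "finite A"
      using finite_UNIV_direction by (meson finite_SigmaI finite_atLeastAtMost_int finite_subset)
    show "?F s \<notin> B" if "s \<in> A" for s
      using that F(2)[of s] by (auto simp: A_def B_def)
    show "?R (?F s) \<in> A" if "s \<in> A" for s
    proof -
      have "head (?F s) \<in> {0..int n + 1}"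
        using that F(2)[of s] step[of "snd (?F s)"] by (auto simp: A_def head_def)
      then show ?thesis
        using that R[of "?F s"] F(2)[of s] by (auto simp: A_def strip_def mem_Times_iff)
    qed
    show "?R ` B \<inter> A = {}"
      using R(3) by (auto simp: A_def B_def)
    have "card B = 2 * n + 1"
      unfolding B_def by (subst card_image) (auto simp: inj_on_def)
    then show "odd (card B)"
      by simp
  qed (rule that)
  obtain x where x: "x \<in> {- int n..int n}" "s = ((x, 0), North)"
    using sk(1) by (auto simp: B_def)
  have "head ((?F ^^ k) s) = int n + 1"
  proof (cases k)
    \<comment> \<open>The initial edge has its head in row 1, so an exit at time 0 means
      \<open>n = 0\<close>.\<close>
    case 0
    then show ?thesis
      using sk(2) x by (auto simp: A_def head_def)
  next
    case (Suc j)
    define t where "t = (?F ^^ k) s"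
    have t: "t = ?F ((?F ^^ j) s)"
      by (simp add: t_def Suc)
    have row: "snd (fst t) \<in> {1..int n}" and col: "fst t \<in> strip n"
      using sk(4)[of j] Suc F unfolding t by (auto simp: A_def)
    have "head t \<notin> {1..int n}"
      using sk(2) row col by (auto simp: A_def strip_def mem_Times_iff simp flip: t_def)
    \<comment> \<open>An edge from row 1 down to row 0 is the reversal of an element of
      \<open>B\<close>, which \<open>sk(3)\<close> excludes.\<close>
    moreover have "head t \<noteq> 0"
    proof
      assume head: "head t = 0"
      obtain a b d where abd: "t = ((a, b), d)"
        by (metis surj_pair)
      have "b + snd (unit_step d) = 0" "b \<ge> 1"
        using head row by (simp_all add: head_def abd)
      then have "b = 1 \<and> d = South"
        by (cases d) auto
      moreover have "a \<in> {- int n..int n}"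
        using col by (auto simp: abd strip_def)
      ultimately have "t = ?R ((a, 0), North)"
        by (auto simp: abd cylinder_reverse_def wrap_id strip_def)
      then show False
        using sk(3) \<open>a \<in> _\<close> by (auto simp: B_def simp flip: t_def)
    qed
    ultimately show ?thesis
      using row step[of "snd t"] by (auto simp: head_def simp flip: t_def)
  qed
  \<comment> \<open>The edge at time \<open>k\<close> has its head in row \<open>n + 1\<close>; the
    orbit is at that head at time \<open>Suc k\<close>.\<close>
  then have "snd (fst ((?F ^^ Suc k) ((x, 0), North))) = int n + 1"
    using F(2) x(2) by simp
  with x(1) show ?thesis
    by (rule that)
qed

section \<open>Rotations of the cylinder and comparison with the planar ray\<close>

definition rotate_strip :: "nat \<Rightarrow> int \<Rightarrow> vertex \<Rightarrow> vertex" where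
  "rotate_strip n x v = (if v \<in> strip n then wrap n (v + (x, 0)) else v)"

text \<open>Fixing all vertices off the strip makes the rotation injective on the whole plane, so
  that it can reindex the product measure.\<close>

lemma inj_rotate_strip: "inj (rotate_strip n x)"
proof (rule inj_on_inverseI)
  show "rotate_strip n (- x) (rotate_strip n x v) = v" for v
  proof (cases "v \<in> strip n")
    case True
    then have "rotate_strip n (- x) (rotate_strip n x v) = wrap n (v + (x, 0) + (- x, 0))"
      by (simp only: rotate_strip_def wrap_in_strip wrap_wrap_add if_True)
    also have "v + (x, 0) + (- x, 0) = v"
      by (cases v) simp
    finally show ?thesis
      using True by (simp add: wrap_id)
  qed (simp add: rotate_strip_def)
qed

text \<open>Rotational equivariance: moving the start amounts to pulling the configuration back
  along the rotation.\<close>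

lemma cylinder_step_rotate:
  assumes "v \<in> strip n"
  shows "cylinder_step n \<omega> (rotate_strip n x v, d)
    = map_prod (rotate_strip n x) id (cylinder_step n (\<omega> \<circ> rotate_strip n x) (v, d))"
proof -
  have "wrap n (rotate_strip n x v + unit_step d) = rotate_strip n x (wrap n (v + unit_step d))"
    using assms by (simp add: rotate_strip_def wrap_in_strip wrap_wrap_add add.assoc
        add.commute[of "(x, 0)"])
  then show ?thesis
    by (simp add: cylinder_step_def Let_def)
qed

lemma cylinder_orbit_in_strip:
  "fst s \<in> strip n \<Longrightarrow> fst ((cylinder_step n \<omega> ^^ k) s) \<in> strip n"
  by (cases k) (auto simp: cylinder_step_def Let_def wrap_in_strip)

lemma cylinder_orbit_rotate:
  assumes "v \<in> strip n"
  shows "(cylinder_step n \<omega> ^^ k) (rotate_strip n x v, d)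
    = map_prod (rotate_strip n x) id ((cylinder_step n (\<omega> \<circ> rotate_strip n x) ^^ k) (v, d))"
proof (induction k)
  case (Suc k)
  obtain w e where we: "(cylinder_step n (\<omega> \<circ> rotate_strip n x) ^^ k) (v, d) = (w, e)"
    by (metis surj_pair)
  then have "w \<in> strip n"
    using assms cylinder_orbit_in_strip[of "(v, d)" n k "\<omega> \<circ> rotate_strip n x"] by simp
  have orbit: "(cylinder_step n \<omega> ^^ k) (rotate_strip n x v, d) = (rotate_strip n x w, e)"
    unfolding Suc we by (simp only: map_prod_simp id_apply)
  have Suc_step: "(F ^^ Suc k) s = F ((F ^^ k) s)" for F :: "vertex \<times> direction \<Rightarrow> _" and s
    by simp
  show ?case
    unfolding Suc_step orbit we using \<open>w \<in> strip n\<close> by (rule cylinder_step_rotate)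
qed simp

text \<open>On a ray that stays in the box, \<open>wrap\<close> fixes every vertex reached, so plane
  and cylinder prescribe the same motion.\<close>

lemma ray_eq_cylinder_orbit:
  assumes "\<not> ray_reaches \<omega> d\<^sub>0 (- lattice_box n)"
  shows "ray \<omega> d\<^sub>0 k = (cylinder_step n \<omega> ^^ k) ((0, 0), d\<^sub>0)"
proof (induction k)
  case (Suc k)
  obtain v d where vd: "ray \<omega> d\<^sub>0 k = (v, d)"
    by (metis surj_pair)
  have "fst (ray \<omega> d\<^sub>0 (Suc k)) \<in> lattice_box n"
    using assms unfolding ray_reaches_def by blast
  then have "v + unit_step d \<in> strip n"
    using vd by (auto simp: Let_def lattice_box_def strip_def)
  have "(cylinder_step n \<omega> ^^ k) ((0, 0), d\<^sub>0) = (v, d)"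
    using Suc vd by simp
  then have "(cylinder_step n \<omega> ^^ Suc k) ((0, 0), d\<^sub>0) = cylinder_step n \<omega> (v, d)"
    by simp
  moreover have "cylinder_step n \<omega> (v, d) = (v + unit_step d, deflect (\<omega> (v + unit_step d)) d)"
    using \<open>v + unit_step d \<in> strip n\<close> by (simp add: cylinder_step_def Let_def wrap_id)
  ultimately show ?case
    using vd by (simp add: Let_def del: funpow.simps)
qed simp

text \<open>The start \<open>(x, 0)\<close> of an escaping cylinder orbit is rotated to the origin.
  A planar ray confined to the box would follow the rotated orbit into row \<open>n + 1\<close>, a
  contradiction.\<close>

lemma some_rotation_reaches_North:
  "\<exists>x\<in>{- int n..int n}. ray_reaches (\<omega> \<circ> rotate_strip n x) North (- lattice_box n)"
proof -
  obtain x k where x: "x \<in> {- int n..int n}"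
    and top: "snd (fst ((cylinder_step n \<omega> ^^ Suc k) ((x, 0), North))) = int n + 1"
    by (rule cylinder_escape)
  let ?\<omega> = "\<omega> \<circ> rotate_strip n x"
  have origin: "(0, 0) \<in> strip n" and "rotate_strip n x (0, 0) = (x, 0)"
    using x by (auto simp: rotate_strip_def strip_def wrap_id)
  then have "(cylinder_step n \<omega> ^^ Suc k) ((x, 0), North)
      = map_prod (rotate_strip n x) id ((cylinder_step n ?\<omega> ^^ Suc k) ((0, 0), North))"
    using cylinder_orbit_rotate[OF origin, where k = "Suc k" and x = x] by metis
  moreover have "snd (rotate_strip n x v) = snd v" for v
    by (simp add: rotate_strip_def)
  ultimately have *: "snd (fst ((cylinder_step n ?\<omega> ^^ Suc k) ((0, 0), North))) = int n + 1"
    using top by (simp del: funpow.simps)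
  have "ray_reaches ?\<omega> North (- lattice_box n)"
  proof (rule ccontr)
    assume contr: "\<not> ?thesis"
    then have "fst (ray ?\<omega> North (Suc k)) \<in> lattice_box n"
      unfolding ray_reaches_def by blast
    then show False
      using * unfolding ray_eq_cylinder_orbit[OF contr] lattice_box_def
      by (simp add: mem_Times_iff)
  qed
  with x show ?thesis
    by blast
qed

section \<open>Lattice symmetries\<close>

text \<open>
  The symmetry carrying north to the given direction is chosen in the group generated by the
  reflection in the diagonal and the point reflection, as these preserve both types of mirror.
\<close>

fun to_North :: "direction \<Rightarrow> vertex \<Rightarrow> vertex" where
  "to_North North (a, b) = (a, b)"
| "to_North South (a, b) = (- a, - b)"
| "to_North East (a, b) = (b, a)"
| "to_North West (a, b) = (- b, - a)"

fun turn :: "direction \<Rightarrow> direction \<Rightarrow> direction" where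
  "turn North d = d"
| "turn South d = opposite d"
| "turn East North = East"
| "turn East East = North"
| "turn East South = West"
| "turn East West = South"
| "turn West North = West"
| "turn West West = North"
| "turn West South = East"
| "turn West East = South"

lemma to_North_involution: "to_North d\<^sub>0 (to_North d\<^sub>0 v) = v"
  by (cases d\<^sub>0; cases v) auto

lemma to_North_add: "to_North d\<^sub>0 (u + v) = to_North d\<^sub>0 u + to_North d\<^sub>0 v"
  by (cases d\<^sub>0; cases u; cases v) auto

lemma to_North_unit_step: "to_North d\<^sub>0 (unit_step d) = unit_step (turn d\<^sub>0 d)"
  by (cases d\<^sub>0; cases d) auto

lemma deflect_turn: "deflect m (turn d\<^sub>0 d) = turn d\<^sub>0 (deflect m d)"
  by (cases m; cases d\<^sub>0; cases d) auto

lemma to_North_in_lattice_box: "to_North d\<^sub>0 v \<in> lattice_box n \<longleftrightarrow> v \<in> lattice_box n"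
  by (cases d\<^sub>0; cases v) (auto simp: lattice_box_def)

lemma ray_turn:
  "ray \<omega> (turn d\<^sub>0 d) k = map_prod (to_North d\<^sub>0) (turn d\<^sub>0) (ray (\<omega> \<circ> to_North d\<^sub>0) d k)"
proof (induction k)
  case 0
  show ?case
    by (cases d\<^sub>0) auto
next
  case (Suc k)
  then show ?case
    by (simp add: Let_def split_beta to_North_add to_North_unit_step deflect_turn)
qed

lemma ray_reaches_turn:
  "ray_reaches \<omega> d\<^sub>0 (- lattice_box n) \<longleftrightarrow> ray_reaches (\<omega> \<circ> to_North d\<^sub>0) North (- lattice_box n)"
proof -
  have "turn d\<^sub>0 North = d\<^sub>0"
    by (cases d\<^sub>0) auto
  then show ?thesis
    using ray_turn[of \<omega> d\<^sub>0 North]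
    by (simp add: ray_reaches_def to_North_in_lattice_box)
qed

section \<open>Probability of escape\<close>

text \<open>Composing with an injection selects distinct coordinates of an i.i.d. family, which
  again form an i.i.d. family with the same law.\<close>

lemma measure_mirror_model_reindex:
  assumes "inj f" and "T \<in> sets (mirror_model p)"
  shows "{\<omega>. \<omega> \<circ> f \<in> T} \<in> sets (mirror_model p)"
    and "measure (mirror_model p) {\<omega>. \<omega> \<circ> f \<in> T} = measure (mirror_model p) T"
proof -
  have meas: "(\<lambda>\<omega>. \<omega> \<circ> f) \<in> measurable (mirror_model p) (mirror_model p)"
    unfolding mirror_model_def o_def by (rule measurable_PiM_single') (auto simp: space_PiM)
  have "distr (mirror_model p) (mirror_model p) (\<lambda>\<omega>. \<omega> \<circ> f) = mirror_model p"
    using distr_PiM_reindex[of UNIV "\<lambda>_. measure_pmf (mirror_pmf p)" f UNIV] \<open>inj f\<close>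
    by (simp add: mirror_model_def o_def restrict_def measure_pmf.prob_space_axioms)
  then show "measure (mirror_model p) {\<omega>. \<omega> \<circ> f \<in> T} = measure (mirror_model p) T"
    using measure_distr[OF meas \<open>T \<in> _\<close>] by (simp add: space_mirror_model vimage_def)
  show "{\<omega>. \<omega> \<circ> f \<in> T} \<in> sets (mirror_model p)"
    using measurable_sets[OF meas \<open>T \<in> _\<close>] by (simp add: space_mirror_model vimage_def)
qed

text \<open>Union bound: the pulled-back events cover the space, and each has the probability of
  \<open>T\<close>.\<close>

lemma measure_mirror_model_ge:
  fixes f :: "'i \<Rightarrow> vertex \<Rightarrow> vertex"
  assumes "finite I" and "I \<noteq> {}" and "\<And>i. i \<in> I \<Longrightarrow> inj (f i)"
    and T: "T \<in> sets (mirror_model p)" and cover: "\<And>\<omega>. \<exists>i\<in>I. \<omega> \<circ> f i \<in> T"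
  shows "measure (mirror_model p) T \<ge> 1 / real (card I)"
proof -
  interpret prob_space "mirror_model p"
    by (rule prob_space_mirror_model)
  have "(\<Union>i\<in>I. {\<omega>. \<omega> \<circ> f i \<in> T}) = space (mirror_model p)"
    using cover by (auto simp: space_mirror_model)
  then have "1 = prob (\<Union>i\<in>I. {\<omega>. \<omega> \<circ> f i \<in> T})"
    using prob_space by simp
  also have "\<dots> \<le> (\<Sum>i\<in>I. prob {\<omega>. \<omega> \<circ> f i \<in> T})"
    using assms measure_mirror_model_reindex(1)
    by (intro finite_measure_subadditive_finite) auto
  also have "\<dots> = real (card I) * prob T"
    using assms measure_mirror_model_reindex(2) by simp
  finally show ?thesis
    using assms(1,2) by (simp add: divide_le_eq card_gt_0_iff mult.commute)
qed

theorem mainTheorem1: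
  fixes p :: real and n :: nat and d\<^sub>0 :: direction
  assumes "0 < p" and "p \<le> 1"
  shows "measure (mirror_model p)
           {\<omega> \<in> space (mirror_model p). ray_reaches \<omega> d\<^sub>0 (- lattice_box n)}
         \<ge> 1 / (2 * real n + 1)"
proof -
  let ?T = "{\<omega> \<in> space (mirror_model p). ray_reaches \<omega> d\<^sub>0 (- lattice_box n)}"
  \<comment> \<open>\<open>ray_reaches_turn\<close> composes with \<open>to_North d\<^sub>0\<close>
    once more; this cancels the inner factor and leaves the northward ray in the rotated
    configuration.\<close>
  let ?f = "\<lambda>x. rotate_strip n x \<circ> to_North d\<^sub>0"
  have "measure (mirror_model p) ?T \<ge> 1 / real (card {- int n..int n})"
  proof (rule measure_mirror_model_ge[where f = ?f])
    have "inj (to_North d\<^sub>0)"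
      by (rule inj_on_inverseI) (rule to_North_involution)
    then show "inj (?f x)" for x
      by (intro inj_compose inj_rotate_strip)
    show "\<exists>x\<in>{- int n..int n}. \<omega> \<circ> ?f x \<in> ?T" for \<omega>
    proof -
      have "to_North d\<^sub>0 \<circ> to_North d\<^sub>0 = id"
        by (simp add: fun_eq_iff to_North_involution)
      then have "\<omega> \<circ> ?f x \<circ> to_North d\<^sub>0 = \<omega> \<circ> rotate_strip n x" for x
        by (simp add: o_assoc[symmetric])
      then show ?thesis
        using some_rotation_reaches_North[of n \<omega>]
        by (simp add: ray_reaches_turn[of _ d\<^sub>0] space_mirror_model)
    qed
  qed (auto intro: sets_ray_reaches)
  then show ?thesis
    by (simp add: add.commute)
qed

end
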